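(* Let $X$ be a Banach space, $\tau$ a Hausdorff linear topology on $X$, and $C\subset X$ a convex, bounded, $\tau$-compact set. Let $S$ be a semitopological semigroup which is left reversible or left amenable, and let $\{T_s:s\in S\}$ be a representation of $S$ on $C$ such that $S\times C\ni(s,x)\mapsto T_sx$ is jointly continuous ($C$ with $\tau$) and the family $\mathcal S=\{T_s:s\in S\}$ is (as a semigroup under composition) generated by averaged affine mappings. Then there exists an affine surjective mapping $r:C\to\mathrm{Fix}\,\mathcal S$ with $r\circ r=r$. If moreover $\mathcal S$ is locally $\tau$-equicontinuous, then $r$ can be chosen to be $\tau$-continuous as well.
   Context: An averaged affine mapping is one of the form $T=\alpha I+(1-\alpha)U$ with $\alpha\in(0,1)$ and $U:C\to C$ affine ($U(\lambda x+(1-\lambda)y)=\lambda Ux+(1-\lambda)Uy$ for $\lambda\in[0,1]$). Semitopological semigroup: Hausdorff topology making $s\mapsto ts$, $s\mapsto st$ continuous. Representation: $T_{st}=T_s\circ T_t$. Left reversible: any two closed right ideals intersect. Left amenable: there is $\mu\in LUC(S)^*$ with $\|\mu\|=\mu(1)=1$, $\mu(l_sf)=\mu(f)$, where $(l_sf)(t)=f(st)$ and $LUC(S)$ consists of bounded continuous $f$ with $s\mapsto l_sf$ sup-norm continuous. $\mathrm{Fix}\,\mathcal S$ is the set of common fixed points. Locally $\tau$-equicontinuous: for every $x_0\in C$ and every $\tau$-neighbourhood $B$ of $0$ there is a $\tau$-neighbourhood $V$ of $x_0$ with $T x-Ty\in B$ for all $T\in\mathcal S$ and $x,y\in V\cap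 C$. *)

theory Defs
  imports "HOL-Analysis.Analysis"
begin

definition linear_topology :: "'a::real_vector topology \<Rightarrow> bool" where
  "linear_topology tau \<longleftrightarrow>
     topspace tau = UNIV \<and> Hausdorff_space tau \<and>
     continuous_map (prod_topology tau tau) tau (\<lambda>(x, y). x + y) \<and>
     continuous_map (prod_topology euclideanreal tau) tau (\<lambda>(c, x). c *\<^sub>R x)"

definition semitopological :: "'s::semigroup_mult topology \<Rightarrow> bool" where
  "semitopological Sg \<longleftrightarrow>
     topspace Sg = UNIV \<and> Hausdorff_space Sg \<and>
     (\<forall>t. continuous_map Sg Sg (\<lambda>s. t * s)) \<and>
     (\<forall>t. continuous_map Sg Sg (\<lambda>s. s * t))"

definition right_ideal :: "'s::semigroup_mult set \<Rightarrow> bool" where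
  "right_ideal I \<longleftrightarrow> I \<noteq> {} \<and> (\<forall>a\<in>I. \<forall>s. a * s \<in> I)"

definition left_reversible :: "'s::semigroup_mult topology \<Rightarrow> bool" where
  "left_reversible Sg \<longleftrightarrow>
     (\<forall>I J. closedin Sg I \<and> right_ideal I \<and> closedin Sg J \<and> right_ideal J
            \<longrightarrow> I \<inter> J \<noteq> {})"

definition ltrans :: "'s::semigroup_mult \<Rightarrow> ('s \<Rightarrow> real) \<Rightarrow> 's \<Rightarrow> real" where
  "ltrans s f = (\<lambda>t. f (s * t))"

definition supnorm :: "('s \<Rightarrow> real) \<Rightarrow> real" where
  "supnorm f = (SUP t. \<bar>f t\<bar>)"

definition LUC :: "'s::semigroup_mult topology \<Rightarrow> ('s \<Rightarrow> real) set" where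
  "LUC Sg = {f. continuous_map Sg euclideanreal f \<and> bounded (range f) \<and>
     (\<forall>s0. \<forall>e>0. \<exists>U. openin Sg U \<and> s0 \<in> U \<and>
        (\<forall>s\<in>U. supnorm (\<lambda>t. ltrans s f t - ltrans s0 f t) < e))}"

definition left_amenable :: "'s::semigroup_mult topology \<Rightarrow> bool" where
  "left_amenable Sg \<longleftrightarrow>
     (\<exists>\<mu> :: ('s \<Rightarrow> real) \<Rightarrow> real.
        (\<forall>f\<in>LUC Sg. \<forall>g\<in>LUC Sg. \<mu> (\<lambda>t. f t + g t) = \<mu> f + \<mu> g) \<and>
        (\<forall>f\<in>LUC Sg. \<forall>c. \<mu> (\<lambda>t. c * f t) = c * \<mu> f) \<and>
        (\<exists>K. \<forall>f\<in>LUC Sg. \<bar>\<mu> f\<bar> \<le> K * supnorm f) \<and>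
        (SUP f\<in>{f\<in>LUC Sg. supnorm f \<le> 1}. \<bar>\<mu> f\<bar>) = 1 \<and>
        \<mu> (\<lambda>_. 1) = 1 \<and>
        (\<forall>s. \<forall>f\<in>LUC Sg. \<mu> (ltrans s f) = \<mu> f))"

definition affine_on :: "'a::real_vector set \<Rightarrow> ('a \<Rightarrow> 'b::real_vector) \<Rightarrow> bool" where
  "affine_on C U \<longleftrightarrow>
     (\<forall>x\<in>C. \<forall>y\<in>C. \<forall>l::real. 0 \<le> l \<and> l \<le> 1 \<longrightarrow>
        U (l *\<^sub>R x + (1 - l) *\<^sub>R y) = l *\<^sub>R U x + (1 - l) *\<^sub>R U y)"

definition averaged_affine :: "'a::real_vector set \<Rightarrow> ('a \<Rightarrow> 'a) \<Rightarrow> bool" where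
  "averaged_affine C T \<longleftrightarrow>
     (\<exists>\<alpha>::real. \<exists>U. 0 < \<alpha> \<and> \<alpha> < 1 \<and> U ` C \<subseteq> C \<and> affine_on C U \<and>
        (\<forall>x\<in>C. T x = \<alpha> *\<^sub>R x + (1 - \<alpha>) *\<^sub>R U x))"

definition representation :: "'a set \<Rightarrow> ('s::semigroup_mult \<Rightarrow> 'a \<Rightarrow> 'a) \<Rightarrow> bool" where
  "representation C T \<longleftrightarrow>
     (\<forall>s. T s ` C \<subseteq> C) \<and> (\<forall>s t. \<forall>x\<in>C. T (s * t) x = T s (T t x))"

definition generated_by_averaged_affine :: "'a::real_vector set \<Rightarrow> ('s \<Rightarrow> 'a \<Rightarrow> 'a) \<Rightarrow> bool" where
  "generated_by_averaged_affine C T \<longleftrightarrow>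
     (\<exists>G. (\<forall>g\<in>G. averaged_affine C g) \<and>
        (\<lambda>s. restrict (T s) C) ` UNIV =
          (\<lambda>gs. restrict (foldr (\<circ>) gs id) C) ` {gs. gs \<noteq> [] \<and> set gs \<subseteq> G})"

definition Fix :: "'a set \<Rightarrow> ('s \<Rightarrow> 'a \<Rightarrow> 'a) \<Rightarrow> 'a set" where
  "Fix C T = {x\<in>C. \<forall>s. T s x = x}"

definition tau_nhd :: "'a topology \<Rightarrow> 'a \<Rightarrow> 'a set \<Rightarrow> bool" where
  "tau_nhd tau x V \<longleftrightarrow> (\<exists>W. openin tau W \<and> x \<in> W \<and> W \<subseteq> V)"

definition locally_equicontinuous ::
    "'a::real_vector topology \<Rightarrow> 'a set \<Rightarrow> ('s \<Rightarrow> 'a \<Rightarrow> 'a) \<Rightarrow> bool" where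
  "locally_equicontinuous tau C T \<longleftrightarrow>
     (\<forall>x0\<in>C. \<forall>B. tau_nhd tau 0 B \<longrightarrow>
        (\<exists>V. tau_nhd tau x0 V \<and> (\<forall>s. \<forall>x\<in>V \<inter> C. \<forall>y\<in>V \<inter> C. T s x - T s y \<in> B)))"

end

theory Submission
  imports Defs
begin

text \<open>
  The retraction is a pointwise cluster point of the semigroup itself. The semigroup acts by left
  composition on the compact Hausdorff space \<open>C\<^sup>C\<close>; reversibility of \<open>S\<close>, or an invariant mean
  evaluated on the functions \<open>t \<mapsto> f (T\<^sub>t)\<close> with \<open>f\<close> continuous on \<open>C\<^sup>C\<close>, gives the sets
  \<open>cl {T\<^sub>a\<^sub>t | t \<in> S}\<close>, \<open>a \<in> S\<close>, the finite intersection property, so they have a common point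
  \<open>p\<close>. Taking \<open>a = s\<^sup>n\<close> places \<open>p x\<close> in \<open>T\<^sub>s\<^sup>n C\<close> for every \<open>n\<close>. If \<open>T\<^sub>s = \<alpha> I + (1 - \<alpha>) U\<close> is a
  generator, then expanding its powers binomially shows that \<open>T\<^sub>s\<^sup>n\<^sup>+\<^sup>1 u - T\<^sub>s\<^sup>n u\<close> lies in
  \<open>c\<^sub>n (C - C)\<close> with \<open>c\<^sub>n \<rightarrow> 0\<close>, and since \<open>C\<close> is \<open>\<tau>\<close>-compact this forces \<open>T\<^sub>s p x = p x\<close>.
  Affinity, the identity on the fixed points and equicontinuity pass to pointwise limits.
\<close>

section \<open>Asymptotic regularity of averaged affine maps\<close>

text \<open>The first absolute central moment of the binomial distribution is controlled by its
  variance \<open>n * x * (1 - x)\<close>, which is at most \<open>n\<close>. The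
  arithmetic-geometric mean inequality, weighted by \<open>sqrt n\<close>, turns each deviation into
  a square and so replaces Cauchy-Schwarz.\<close>

lemma sum_abs_central_Bernstein_le:
  assumes "0 \<le> x" "x \<le> 1" "0 < n"
  shows "(\<Sum>k\<le>n. \<bar>real k - real n * x\<bar> * Bernstein n k x) \<le> sqrt n"
proof -
  have var: "(\<Sum>k\<le>n. (real k - real n * x)\<^sup>2 * Bernstein n k x) = real n * x * (1 - x)"
  proof -
    have "(\<Sum>k\<le>n. (real k - real n * x)\<^sup>2 * Bernstein n k x)
        = (\<Sum>k\<le>n. real k * (real k - 1) * Bernstein n k x
             + (1 - 2 * n * x) * (real k * Bernstein n k x) + (n * x)\<^sup>2 * Bernstein n k x)"
      by (intro sum.cong) (auto simp: algebra_simps power2_eq_square)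
    also have "\<dots> = real n * (real n - 1) * x\<^sup>2 + (1 - 2 * n * x) * (n * x) + (n * x)\<^sup>2"
      by (simp add: sum.distrib flip: sum_distrib_left)
    also have "\<dots> = real n * x * (1 - x)"
      by (simp add: algebra_simps power2_eq_square)
    finally show ?thesis .
  qed
  have sq: "0 < sqrt n" "sqrt n * sqrt n = n" using assms by auto
  have amgm: "\<bar>a\<bar> \<le> (a\<^sup>2 / sqrt n + sqrt n) / 2" for a :: real
  proof -
    have "2 * \<bar>a\<bar> * sqrt n \<le> \<bar>a\<bar>\<^sup>2 + (sqrt n)\<^sup>2"
      by (rule sum_squares_bound)
    then show ?thesis using sq by (simp add: field_simps power2_eq_square)
  qed
  have "x * (1 - x) \<le> 1 * 1"
    using assms by (intro mult_mono) auto
  then have "real n * (x * (1 - x)) \<le> n"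
    using mult_left_mono[of "x * (1 - x)" 1 "real n"] by simp
  then have le: "real n * x * (1 - x) / sqrt n \<le> sqrt n"
    using sq by (simp add: field_simps)
  have "(\<Sum>k\<le>n. \<bar>real k - real n * x\<bar> * Bernstein n k x)
      \<le> (\<Sum>k\<le>n. ((real k - real n * x)\<^sup>2 / sqrt n + sqrt n) / 2 * Bernstein n k x)"
    using assms by (intro sum_mono mult_right_mono amgm Bernstein_nonneg) auto
  also have "\<dots> = (\<Sum>k\<le>n. inverse (2 * sqrt n) * ((real k - real n * x)\<^sup>2 * Bernstein n k x)
        + sqrt n / 2 * Bernstein n k x)"
    using sq by (intro sum.cong) (auto simp: field_simps)
  also have "\<dots> = inverse (2 * sqrt n) * (real n * x * (1 - x)) + sqrt n / 2"
    unfolding sum.distrib sum_distrib_left[symmetric] var sum_Bernstein by simp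
  also have "\<dots> = (real n * x * (1 - x) / sqrt n + sqrt n) / 2"
    using sq by (simp add: divide_simps)
  also have "\<dots> \<le> sqrt n"
    using le by simp
  finally show ?thesis .
qed

text \<open>Absorption, \<open>(n + 1 - k) * (n + 1 choose k) = (n + 1) * (n choose k)\<close>,
  makes one weight a multiple of the other. The change of weights from \<open>n\<close> to
  \<open>n + 1\<close> is thus a central deviation, and the moment bound above applies to it. The
  case \<open>k = Suc n\<close> is included so that both families can be compared on one index
  set.\<close>

lemma Bernstein_Suc_diff:
  assumes "x < 1" "k \<le> Suc n"
  shows "Bernstein (Suc n) k x - Bernstein n k x
       = (real k - real (Suc n) * x) * Bernstein (Suc n) k x / (real (Suc n) * (1 - x))"
proof -
  have "real (Suc n) * (1 - x) * Bernstein n k x = real (Suc n - k) * Bernstein (Suc n) k x"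
  proof (cases "k \<le> n")
    case True
    then obtain m where m: "n = k + m" using le_Suc_ex by blast
    have "real (Suc n - k) * real (Suc n choose k) = real (Suc n) * real (n choose k)"
      using binomial_absorb_comp[of "Suc n" k] by (metis diff_Suc_1 of_nat_mult)
    then have "real (Suc n - k) * real (Suc n choose k) * (x ^ k * (1 - x) ^ Suc m)
        = real (Suc n) * real (n choose k) * (x ^ k * (1 - x) ^ Suc m)"
      by simp
    moreover have "n - k = m" "Suc n - k = Suc m" using m by auto
    ultimately show ?thesis
      unfolding Bernstein_def by (simp only: power_Suc mult_ac)
  next
    case False
    with assms have "k = Suc n" by simp
    then show ?thesis by (simp add: Bernstein_def)
  qed
  moreover have "real (Suc n - k) = real (Suc n) - real k"
    using assms by (simp add: of_nat_diff)
  ultimately have "(Bernstein (Suc n) k x - Bernstein n k x) * (real (Suc n) * (1 - x))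
      = (real k - real (Suc n) * x) * Bernstein (Suc n) k x"
    by (simp add: algebra_simps)
  moreover have "real (Suc n) * (1 - x) \<noteq> 0"
    using assms by (simp del: of_nat_Suc)
  ultimately show ?thesis
    by (metis nonzero_eq_divide_eq)
qed

text \<open>Pascal's rule. It holds for all \<open>k\<close> because the binomial coefficients
  vanish beyond the top index.\<close>

lemma Bernstein_Suc_Suc:
  "Bernstein (Suc n) (Suc k) x = (1 - x) * Bernstein n (Suc k) x + x * Bernstein n k x"
proof (cases "k < n")
  case True
  then have "n - k = Suc (n - Suc k)" by simp
  then show ?thesis by (simp add: Bernstein_def algebra_simps)
next
  case False
  then show ?thesis by (cases "k = n") (auto simp: Bernstein_def binomial_eq_0)
qed

lemma Bernstein_Suc_0: "Bernstein (Suc n) 0 x = (1 - x) * Bernstein n 0 x"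
  by (simp add: Bernstein_def)

section \<open>Powers of an averaged affine map\<close>

lemma affine_on_funpow:
  assumes "convex C" "U ` C \<subseteq> C" "affine_on C U"
  shows "(U ^^ k) ` C \<subseteq> C \<and> affine_on C (U ^^ k)"
proof (induction k)
  case (Suc k)
  then have "(U ^^ k) x \<in> C" if "x \<in> C" for x using that by auto
  with Suc assms show ?case
    by (auto simp: affine_on_def image_subset_iff)
qed (auto simp: affine_on_def)

text \<open>The binomial expansion of the n-th power of \<open>a I + (1 - a) U\<close>. The
  induction peels off the innermost factor: \<open>T x\<close> is a combination of only two points,
  so affinity of \<open>U ^^ k\<close> in its two-point form suffices, and Pascal's rule collects
  the weights.\<close>

lemma averaged_funpow_eq_Bernstein:
  fixes C :: "'a::real_vector set"
  assumes "convex C" "U ` C \<subseteq> C" "affine_on C U" "0 \<le> a" "a \<le> 1"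
    and T: "\<And>x. x \<in> C \<Longrightarrow> T x = a *\<^sub>R x + (1 - a) *\<^sub>R U x"
    and "x \<in> C"
  shows "(T ^^ n) x = (\<Sum>k\<le>n. Bernstein n k (1 - a) *\<^sub>R (U ^^ k) x)"
  using \<open>x \<in> C\<close>
proof (induction n arbitrary: x)
  case 0
  then show ?case by (simp add: Bernstein_def)
next
  case (Suc n)
  let ?b = "\<lambda>n k. Bernstein n k (1 - a)"
  have Tx: "T x \<in> C"
    unfolding T[OF Suc.prems] using assms(1-5) Suc.prems
    by (intro convexD) auto
  have U: "(U ^^ k) (T x) = a *\<^sub>R (U ^^ k) x + (1 - a) *\<^sub>R (U ^^ Suc k) x" for k
  proof -
    have "U x \<in> C" using assms Suc.prems by blast
    with affine_on_funpow[OF assms(1-3), of k] Suc.prems assms(4,5)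
    have "(U ^^ k) (a *\<^sub>R x + (1 - a) *\<^sub>R U x) = a *\<^sub>R (U ^^ k) x + (1 - a) *\<^sub>R (U ^^ k) (U x)"
      unfolding affine_on_def by blast
    then show ?thesis by (simp add: T Suc.prems funpow_swap1)
  qed
  have "(T ^^ Suc n) x = (T ^^ n) (T x)"
    by (simp add: funpow_swap1)
  also have "\<dots> = (\<Sum>k\<le>n. ?b n k *\<^sub>R (U ^^ k) (T x))"
    using Suc.IH[OF Tx] .
  also have "\<dots> = (\<Sum>k\<le>n. (a * ?b n k) *\<^sub>R (U ^^ k) x) + (\<Sum>k\<le>n. ((1 - a) * ?b n k) *\<^sub>R (U ^^ Suc k) x)"
    unfolding U by (simp add: scaleR_add_right sum.distrib mult.commute)
  \<comment> \<open>The added term is zero since \<open>n choose Suc n = 0\<close>; after splitting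
    off index 0, both sums run over the powers \<open>U ^^ Suc k\<close> with \<open>k\<close> up to
    \<open>n\<close>.\<close>
  also have "(\<Sum>k\<le>n. (a * ?b n k) *\<^sub>R (U ^^ k) x) = (\<Sum>k\<le>Suc n. (a * ?b n k) *\<^sub>R (U ^^ k) x)"
    by (simp add: Bernstein_def)
  also have "\<dots> = (a * ?b n 0) *\<^sub>R x + (\<Sum>k\<le>n. (a * ?b n (Suc k)) *\<^sub>R (U ^^ Suc k) x)"
    by (subst sum.atMost_Suc_shift) simp
  also have "\<dots> + (\<Sum>k\<le>n. ((1 - a) * ?b n k) *\<^sub>R (U ^^ Suc k) x)
      = ?b (Suc n) 0 *\<^sub>R x + (\<Sum>k\<le>n. ?b (Suc n) (Suc k) *\<^sub>R (U ^^ Suc k) x)"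
    by (simp add: Bernstein_Suc_Suc Bernstein_Suc_0 scaleR_add_left sum.distrib del: funpow.simps)
  also have "\<dots> = (\<Sum>k\<le>Suc n. ?b (Suc n) k *\<^sub>R (U ^^ k) x)"
    by (subst sum.atMost_Suc_shift) simp
  finally show ?case .
qed

text \<open>The positive and the negative part of \<open>d\<close> have the same total mass
  \<open>c\<close>. Dividing each by \<open>c\<close> gives two convex combinations, the points
  \<open>y\<close> and \<open>z\<close>. If \<open>c = 0\<close>, all coefficients vanish and any
  point of the nonempty family serves as both.\<close>

lemma zero_sum_combination_in_convex:
  fixes u :: "'i \<Rightarrow> 'a::real_vector"
  assumes "finite I" "convex C" "\<And>i. i \<in> I \<Longrightarrow> u i \<in> C" "I \<noteq> {}" "(\<Sum>i\<in>I. d i) = 0"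
  obtains c y z where "0 \<le> c" "c \<le> (\<Sum>i\<in>I. \<bar>d i\<bar>)" "y \<in> C" "z \<in> C"
    "(\<Sum>i\<in>I. d i *\<^sub>R u i) = c *\<^sub>R (y - z)"
proof -
  define c where "c = (\<Sum>i\<in>I. max (d i) 0)"
  have c0: "0 \<le> c" unfolding c_def by (intro sum_nonneg) auto
  have "c = (\<Sum>i\<in>I. d i + max (- d i) 0)"
    unfolding c_def by (intro sum.cong) auto
  then have c': "c = (\<Sum>i\<in>I. max (- d i) 0)"
    using assms(5) by (simp add: sum.distrib)
  have cle: "c \<le> (\<Sum>i\<in>I. \<bar>d i\<bar>)" unfolding c_def by (intro sum_mono) auto
  show thesis
  proof (cases "c = 0")
    case True
    have "\<forall>i\<in>I. max (d i) 0 = 0"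
      using True assms(1) unfolding c_def by (subst (asm) sum_nonneg_eq_0_iff) auto
    moreover have "\<forall>i\<in>I. max (- d i) 0 = 0"
      using True assms(1) unfolding c' by (subst (asm) sum_nonneg_eq_0_iff) auto
    ultimately have "\<forall>i\<in>I. d i = 0"
      by (metis max.absorb_iff2 neg_le_0_iff_le order_antisym max.cobounded2 max_def)
    then have "(\<Sum>i\<in>I. d i *\<^sub>R u i) = 0" by simp
    moreover obtain i where "i \<in> I" using assms by blast
    ultimately show thesis using that[of 0 "u i" "u i"] assms(3) by (simp add: sum_nonneg)
  next
    case False
    have s: "(\<Sum>i\<in>I. e i / c) = 1" if "c = (\<Sum>i\<in>I. e i)" for e
      using False by (simp flip: sum_divide_distrib that)
    have "(\<Sum>i\<in>I. (max (d i) 0 / c) *\<^sub>R u i) \<in> C"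
      using assms c0 by (intro convex_sum s c_def) auto
    moreover have "(\<Sum>i\<in>I. (max (- d i) 0 / c) *\<^sub>R u i) \<in> C"
      using assms c0 by (intro convex_sum s c') auto
    moreover have "(\<Sum>i\<in>I. d i *\<^sub>R u i) = c *\<^sub>R ((\<Sum>i\<in>I. (max (d i) 0 / c) *\<^sub>R u i)
        - (\<Sum>i\<in>I. (max (- d i) 0 / c) *\<^sub>R u i))"
    proof -
      have "d i = max (d i) 0 - max (- d i) 0" for i by auto
      then have "(\<Sum>i\<in>I. d i *\<^sub>R u i) = (\<Sum>i\<in>I. max (d i) 0 *\<^sub>R u i - max (- d i) 0 *\<^sub>R u i)"
        by (metis scaleR_left_diff_distrib)
      then show ?thesis
        using False by (simp add: scaleR_diff_right scaleR_sum_right sum_subtractf)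
    qed
    ultimately show thesis using that c0 cle by blast
  qed
qed

text \<open>By the expansion, the difference of consecutive powers has as coefficients the
  differences of consecutive Bernstein weights. These sum to 0, and their absolute values sum to at
  most \<open>1 / (a * sqrt (Suc n))\<close> by the difference formula and the moment bound at
  \<open>x = 1 - a\<close>.\<close>

lemma averaged_asymptotically_regular:
  fixes C :: "'a::real_vector set"
  assumes "convex C" "U ` C \<subseteq> C" "affine_on C U" "0 < a" "a < 1"
    and T: "\<And>x. x \<in> C \<Longrightarrow> T x = a *\<^sub>R x + (1 - a) *\<^sub>R U x"
    and "x \<in> C"
  obtains c y z where "0 \<le> c" "c \<le> 1 / (a * sqrt (Suc n))" "y \<in> C" "z \<in> C"
    "(T ^^ Suc n) x - (T ^^ n) x = c *\<^sub>R (y - z)"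
proof -
  let ?b = "\<lambda>n k. Bernstein n k (1 - a)"
  define d where "d k = ?b (Suc n) k - ?b n k" for k
  have b0: "?b n (Suc n) = 0" by (simp add: Bernstein_def)
  have pow: "(T ^^ m) x = (\<Sum>k\<le>m. ?b m k *\<^sub>R (U ^^ k) x)" for m
    by (rule averaged_funpow_eq_Bernstein[OF assms(1-3)]) (use assms in auto)
  have "(T ^^ n) x = (\<Sum>k\<le>Suc n. ?b n k *\<^sub>R (U ^^ k) x)"
    unfolding pow using b0 by simp
  then have eq: "(T ^^ Suc n) x - (T ^^ n) x = (\<Sum>k\<le>Suc n. d k *\<^sub>R (U ^^ k) x)"
    unfolding pow[of "Suc n"] d_def scaleR_left_diff_distrib sum_subtractf by simp
  have "(\<Sum>k\<le>Suc n. ?b n k) = 1"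
    using b0 sum_Bernstein[of n "1 - a"] by simp
  then have d0: "(\<Sum>k\<le>Suc n. d k) = 0"
    unfolding d_def sum_subtractf by (simp only: sum_Bernstein)
  have "(\<Sum>k\<le>Suc n. \<bar>d k\<bar>)
      = (\<Sum>k\<le>Suc n. \<bar>real k - real (Suc n) * (1 - a)\<bar> * ?b (Suc n) k / (real (Suc n) * a))"
  proof (intro sum.cong refl)
    fix k assume "k \<in> {..Suc n}"
    then have "d k = (real k - real (Suc n) * (1 - a)) * ?b (Suc n) k / (real (Suc n) * a)"
      unfolding d_def using Bernstein_Suc_diff[of "1 - a" k n] assms by simp
    moreover have "0 \<le> ?b (Suc n) k" using assms by (intro Bernstein_nonneg) auto
    ultimately show "\<bar>d k\<bar> = \<bar>real k - real (Suc n) * (1 - a)\<bar> * ?b (Suc n) k / (real (Suc n) * a)"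
      using assms by (simp add: abs_mult)
  qed
  also have "\<dots> \<le> sqrt (Suc n) / (real (Suc n) * a)"
    unfolding sum_divide_distrib[symmetric]
    using assms by (intro divide_right_mono sum_abs_central_Bernstein_le) auto
  also have "\<dots> = 1 / (a * sqrt (Suc n))"
    using \<open>0 < a\<close> real_sqrt_pow2[of "real (Suc n)"]
    by (simp add: divide_simps power2_eq_square del: real_sqrt_pow2 of_nat_Suc)
  finally have d1: "(\<Sum>k\<le>Suc n. \<bar>d k\<bar>) \<le> 1 / (a * sqrt (Suc n))" .
  have "(U ^^ k) x \<in> C" for k
    using affine_on_funpow[OF assms(1-3), of k] assms by auto
  then obtain c y z where "0 \<le> c" "c \<le> (\<Sum>k\<le>Suc n. \<bar>d k\<bar>)" "y \<in> C" "z \<in> C"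
    "(\<Sum>k\<le>Suc n. d k *\<^sub>R (U ^^ k) x) = c *\<^sub>R (y - z)"
    using zero_sum_combination_in_convex[OF finite_atMost assms(1) _ _ d0,
        of "\<lambda>k. (U ^^ k) x" thesis] by blast
  with d1 show thesis
    by (intro that[of c y z]) (simp_all only: eq)
qed

section \<open>Linear topologies\<close>

lemma linear_topology_continuous_add:
  assumes "linear_topology tau" "continuous_map X tau f" "continuous_map X tau g"
  shows "continuous_map X tau (\<lambda>x. f x + g x)"
proof -
  have "continuous_map X (prod_topology tau tau) (\<lambda>x. (f x, g x))"
    using assms by (intro continuous_map_pairedI)
  moreover have "continuous_map (prod_topology tau tau) tau (\<lambda>(x, y). x + y)"
    using assms by (simp add: linear_topology_def)
  ultimately show ?thesis
    using continuous_map_compose by (fastforce simp: o_def)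
qed

lemma linear_topology_continuous_scaleR:
  assumes "linear_topology tau" "continuous_map X euclideanreal c" "continuous_map X tau f"
  shows "continuous_map X tau (\<lambda>x. c x *\<^sub>R f x)"
proof -
  have "continuous_map X (prod_topology euclideanreal tau) (\<lambda>x. (c x, f x))"
    using assms by (intro continuous_map_pairedI)
  moreover have "continuous_map (prod_topology euclideanreal tau) tau (\<lambda>(c, x). c *\<^sub>R x)"
    using assms by (simp add: linear_topology_def)
  ultimately show ?thesis
    using continuous_map_compose by (fastforce simp: o_def)
qed

lemma linear_topology_continuous_diff:
  assumes "linear_topology tau" "continuous_map X tau f" "continuous_map X tau g"
  shows "continuous_map X tau (\<lambda>x. f x - g x)"
  using linear_topology_continuous_add[OF assms(1,2)
      linear_topology_continuous_scaleR[OF assms(1) _ assms(3), of "\<lambda>_. -1"]]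
  by simp

text \<open>A compact set is bounded for a linear topology. The continuous map
  \<open>(c, y, z)\<close> to \<open>c (y - z)\<close> is 0, hence different from \<open>v\<close>,
  on the compact slice \<open>c = 0\<close>; the tube lemma thickens this slice.\<close>

lemma compact_differences_absorbed:
  assumes "linear_topology tau" "compactin tau C" "v \<noteq> 0"
  obtains \<delta> where "0 < \<delta>" "\<And>c y z. \<lbrakk>\<bar>c\<bar> < \<delta>; y \<in> C; z \<in> C\<rbrakk> \<Longrightarrow> c *\<^sub>R (y - z) \<noteq> v"
proof -
  let ?X = "prod_topology euclideanreal (prod_topology tau tau)"
  let ?f = "\<lambda>w. fst w *\<^sub>R (fst (snd w) - snd (snd w))"
  have ts: "topspace tau = UNIV" "Hausdorff_space tau"
    using assms by (auto simp: linear_topology_def)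
  have "continuous_map ?X tau (\<lambda>w. fst (snd w))" "continuous_map ?X tau (\<lambda>w. snd (snd w))"
    using continuous_map_compose[OF continuous_map_snd continuous_map_fst]
      continuous_map_compose[OF continuous_map_snd continuous_map_snd]
    by (auto simp: o_def)
  then have "continuous_map ?X tau ?f"
    by (intro linear_topology_continuous_scaleR linear_topology_continuous_diff assms(1)
        continuous_map_fst)
  moreover have "openin tau (UNIV - {v})"
    using ts by (metis UNIV_I closedin_Hausdorff_sing_eq openin_diff openin_topspace)
  ultimately have "openin ?X {w \<in> topspace ?X. ?f w \<in> UNIV - {v}}"
    by (rule openin_continuous_map_preimage)
  moreover have "compactin (prod_topology tau tau) (C \<times> C)"
    using assms by (simp add: compactin_Times)
  ultimately have "\<exists>U V. openin euclideanreal U \<and> openin (prod_topology tau tau) V \<and> 0 \<in> U \<and>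
      C \<times> C \<subseteq> V \<and> U \<times> V \<subseteq> {w \<in> topspace ?X. ?f w \<in> UNIV - {v}}"
    by (rule tube_lemma_right) (use assms(3) ts in auto)
  then obtain U V where UV: "open U" "0 \<in> U" "C \<times> C \<subseteq> V" "U \<times> V \<subseteq> {w. ?f w \<noteq> v}"
    by auto
  then obtain \<delta> where "0 < \<delta>" "\<And>c. \<bar>c\<bar> < \<delta> \<Longrightarrow> c \<in> U"
    by (metis (mono_tags) dist_real_def open_dist diff_zero)
  with UV show thesis
    by (intro that[of \<delta>]) fastforce+
qed

text \<open>Writing \<open>y\<close> as the n-th iterate of some \<open>x\<close> turns
  \<open>T y - y\<close> into a difference of consecutive iterates, a multiple of a vector in
  \<open>C - C\<close> with factor tending to 0 as \<open>n\<close> grows. A nonzero vector cannot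
  be of this form for factors below \<open>\<delta>\<close>.\<close>

lemma averaged_affine_fixes_eventual_range:
  assumes "linear_topology tau" "compactin tau C" "convex C" "averaged_affine C T"
    and y: "\<And>n. y \<in> (T ^^ n) ` C"
  shows "T y = y"
proof (rule ccontr)
  assume "T y \<noteq> y"
  then obtain \<delta> where \<delta>: "0 < \<delta>"
    "\<And>c u v. \<lbrakk>\<bar>c\<bar> < \<delta>; u \<in> C; v \<in> C\<rbrakk> \<Longrightarrow> c *\<^sub>R (u - v) \<noteq> T y - y"
    using compact_differences_absorbed[OF assms(1,2), of "T y - y"] by auto
  obtain a U where a: "0 < a" "a < 1" "U ` C \<subseteq> C" "affine_on C U"
    "\<And>x. x \<in> C \<Longrightarrow> T x = a *\<^sub>R x + (1 - a) *\<^sub>R U x"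
    using assms(4) unfolding averaged_affine_def by auto
  obtain n where "(1 / (a * \<delta>))\<^sup>2 < real n"
    using reals_Archimedean2 by blast
  then have "1 / (a * \<delta>) < sqrt (real (Suc n))"
    by (intro real_less_rsqrt) simp
  then have n: "1 / (a * sqrt (real (Suc n))) < \<delta>"
    using a(1) \<delta>(1) by (simp add: divide_simps mult_ac del: of_nat_Suc)
  obtain x where x: "x \<in> C" "y = (T ^^ n) x" using y by blast
  obtain c u v where "0 \<le> c" "c \<le> 1 / (a * sqrt (Suc n))" "u \<in> C" "v \<in> C"
    "(T ^^ Suc n) x - (T ^^ n) x = c *\<^sub>R (u - v)"
    using averaged_asymptotically_regular[OF assms(3) a(3,4,1,2,5) x(1), of n] by blast
  with \<delta>(2)[of c u v] n x show False by simp
qed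

section \<open>Flows of left reversible and left amenable semigroups\<close>

text \<open>If the functional \<open>M\<close> is supported on \<open>A\<close> and on
  \<open>B\<close>, it is supported on their intersection. Clipping \<open>f\<close> at height
  \<open>e\<close> leaves a part \<open>t\<close> of size at most \<open>e\<close> and a remainder
  \<open>h\<close> living where \<open>f\<close> is large. There \<open>A\<close> and
  \<open>B\<close> are disjoint, so a Urysohn function splits \<open>h\<close> into a piece
  vanishing on \<open>A\<close> and one vanishing on \<open>B\<close>. Hence
  \<open>M f = M t\<close>, and \<open>e\<close> tends to 0.\<close>

lemma mean_vanishing_off_Int:
  fixes M :: "('a \<Rightarrow> real) \<Rightarrow> real"
  assumes "normal_space X" "closedin X A" "closedin X B"
    and add: "\<And>f g. \<lbrakk>continuous_map X euclideanreal f; continuous_map X euclideanreal g\<rbrakk>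
               \<Longrightarrow> M (\<lambda>x. f x + g x) = M f + M g"
    and bound: "\<And>f b. \<lbrakk>continuous_map X euclideanreal f; \<And>x. x \<in> topspace X \<Longrightarrow> \<bar>f x\<bar> \<le> b\<rbrakk>
               \<Longrightarrow> \<bar>M f\<bar> \<le> K * b"
    and A: "\<And>f. \<lbrakk>continuous_map X euclideanreal f; \<And>x. x \<in> A \<Longrightarrow> f x = 0\<rbrakk> \<Longrightarrow> M f = 0"
    and B: "\<And>f. \<lbrakk>continuous_map X euclideanreal f; \<And>x. x \<in> B \<Longrightarrow> f x = 0\<rbrakk> \<Longrightarrow> M f = 0"
    and f: "continuous_map X euclideanreal f" "\<And>x. x \<in> A \<inter> B \<Longrightarrow> f x = 0"
  shows "M f = 0"
proof -
  have "\<bar>M f\<bar> \<le> K * e" if "0 < e" for e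
  proof -
    define t where "t x = max (- e) (min e (f x))" for x
    define h where "h x = f x - t x" for x
    have cont: "continuous_map X euclideanreal t" "continuous_map X euclideanreal h"
      unfolding h_def t_def using f(1) by (intro continuous_intros; simp)+
    let ?E = "{x \<in> topspace X. \<bar>f x\<bar> \<in> {e..}}"
    have E: "closedin X ?E"
      by (rule closedin_continuous_map_preimage[of X euclideanreal])
        (use f(1) in \<open>auto intro: continuous_intros\<close>)
    have "disjnt (A \<inter> ?E) (B \<inter> ?E)"
      using f(2) that by (auto simp: disjnt_def)
    then obtain g where g: "continuous_map X euclideanreal g" "g ` (A \<inter> ?E) \<subseteq> {0::real}"
        "g ` (B \<inter> ?E) \<subseteq> {1}"
      using assms(1-3) E unfolding normal_space_iff_Urysohn_alt by (meson closedin_Int)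
    have h0: "h x = 0" if "x \<in> topspace X" "x \<notin> ?E" for x
      using that by (auto simp: h_def t_def)
    have "M (\<lambda>x. h x * g x) = 0"
    proof (rule A)
      fix x assume "x \<in> A"
      then have "x \<in> topspace X" using assms(2) closedin_subset by blast
      with \<open>x \<in> A\<close> show "h x * g x = 0" using g(2) h0 by (cases "x \<in> ?E") auto
    qed (use cont g in \<open>intro continuous_intros\<close>)
    moreover have "M (\<lambda>x. h x * (1 - g x)) = 0"
    proof (rule B)
      fix x assume "x \<in> B"
      then have "x \<in> topspace X" using assms(3) closedin_subset by blast
      with \<open>x \<in> B\<close> show "h x * (1 - g x) = 0" using g(3) h0 by (cases "x \<in> ?E") auto
    qed (use cont g in \<open>intro continuous_intros; simp\<close>)
    moreover have "M (\<lambda>x. h x * g x + h x * (1 - g x)) = M (\<lambda>x. h x * g x) + M (\<lambda>x. h x * (1 - g x))"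
      by (rule add) (use cont g in \<open>intro continuous_intros; simp\<close>)+
    ultimately have "M h = 0" by (simp add: algebra_simps)
    moreover have "M (\<lambda>x. h x + t x) = M h + M t"
      using cont by (rule add[rotated])
    ultimately have "M f = M t" by (simp add: h_def)
    moreover have "\<bar>M t\<bar> \<le> K * e"
      using cont(1) that by (intro bound) (auto simp: t_def)
    ultimately show ?thesis by simp
  qed
  then have "\<forall>\<^sub>F e in at_right 0. \<bar>M f\<bar> \<le> K * e"
    by (auto simp: eventually_at_filter)
  moreover have "((\<lambda>e. K * e) \<longlongrightarrow> K * 0) (at_right 0)"
    by (intro tendsto_intros)
  ultimately have "\<bar>M f\<bar> \<le> K * 0"
    by (intro tendsto_lowerbound) auto
  then show ?thesis by simp
qed

text \<open>Compactness of \<open>P\<close> makes \<open>f (A s k)\<close> close to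
  \<open>f (A s0 k)\<close> uniformly in \<open>k\<close>, by the tube lemma. Since
  \<open>A (s * t) e = A s (A t e)\<close>, taking \<open>k = A t e\<close> gives closeness of the
  left translates uniformly in \<open>t\<close>.\<close>

lemma flow_orbit_function_in_LUC:
  assumes P: "compact_space P" and Sg: "semitopological Sg"
    and act: "continuous_map (prod_topology Sg P) P (\<lambda>(s, k). A s k)"
    and hom: "\<And>s t k. k \<in> topspace P \<Longrightarrow> A (s * t) k = A s (A t k)"
    and e: "e \<in> topspace P"
    and f: "continuous_map P euclideanreal f"
  shows "(\<lambda>t. f (A t e)) \<in> LUC Sg"
proof -
  have ts: "topspace Sg = UNIV" using Sg by (simp add: semitopological_def)
  have inP: "A s k \<in> topspace P" if "k \<in> topspace P" for s k
    using act that ts by (auto simp: continuous_map_def Pi_iff)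
  have "continuous_map Sg P ((\<lambda>(s, k). A s k) \<circ> (\<lambda>s. (s, e)))"
    using act e by (intro continuous_map_compose[of _ "prod_topology Sg P"] continuous_map_pairedI)
      auto
  from continuous_map_compose[OF this f]
  have "continuous_map Sg euclideanreal (\<lambda>t. f (A t e))"
    by (simp add: o_def)
  moreover have "bounded (range (\<lambda>t. f (A t e)))"
  proof -
    have "compactin euclideanreal (f ` topspace P)"
      using P f image_compactin unfolding compact_space_def by blast
    then have "bounded (f ` topspace P)" by (simp add: compact_imp_bounded)
    then show ?thesis by (rule bounded_subset) (use inP e in auto)
  qed
  moreover have "\<exists>U. openin Sg U \<and> s0 \<in> U \<and>
        (\<forall>s\<in>U. supnorm (\<lambda>t. ltrans s (\<lambda>t. f (A t e)) t - ltrans s0 (\<lambda>t. f (A t e)) t) < d)"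
    if "0 < d" for s0 d
  proof -
    let ?X = "prod_topology Sg P"
    let ?g = "\<lambda>w. \<bar>f (A (fst w) (snd w)) - f (A s0 (snd w))\<bar>"
    have "continuous_map ?X euclideanreal (f \<circ> (\<lambda>(s, k). A s k))"
      by (rule continuous_map_compose[OF act f])
    moreover have "continuous_map ?X euclideanreal (f \<circ> (\<lambda>(s, k). A s k) \<circ> (\<lambda>w. (s0, snd w)))"
      using continuous_map_compose[OF act f] ts
      by (intro continuous_map_compose[of _ "prod_topology Sg P"] continuous_map_pairedI
          continuous_map_snd) auto
    ultimately have "continuous_map ?X euclideanreal ?g"
      by (intro continuous_intros) (simp_all add: o_def case_prod_unfold)
    \<comment> \<open>Half of \<open>d\<close> is used because the supremum turns a strict pointwise
      bound into a weak one.\<close>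
    then have "openin ?X {w \<in> topspace ?X. ?g w \<in> {..<d / 2}}"
      by (rule openin_continuous_map_preimage) simp
    moreover have "compactin P (topspace P)" using P by (simp add: compact_space_def)
    ultimately have "\<exists>U V. openin Sg U \<and> openin P V \<and> s0 \<in> U \<and> topspace P \<subseteq> V \<and>
        U \<times> V \<subseteq> {w \<in> topspace ?X. ?g w \<in> {..<d / 2}}"
      by (rule tube_lemma_right) (use that ts in auto)
    then obtain U where U: "openin Sg U" "s0 \<in> U"
      "\<And>s k. s \<in> U \<Longrightarrow> k \<in> topspace P \<Longrightarrow> \<bar>f (A s k) - f (A s0 k)\<bar> < d / 2"
      by (force simp: subset_iff)
    have "supnorm (\<lambda>t. ltrans s (\<lambda>t. f (A t e)) t - ltrans s0 (\<lambda>t. f (A t e)) t) \<le> d / 2"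
      if "s \<in> U" for s
      unfolding supnorm_def ltrans_def
      by (rule cSUP_least) (use U(3)[OF that inP[OF e]] hom e in \<open>auto intro: less_imp_le\<close>)
    with U that show ?thesis by force
  qed
  ultimately show ?thesis by (simp add: LUC_def)
qed

text \<open>By compactness it suffices that finitely many of the closed sets \<open>Z a\<close>
  meet. Under reversibility, a point common to the closures of the right ideals \<open>a S\<close>
  is carried into all of them by the orbit map. Under amenability, the mean pushed forward along the
  orbit map is supported on each \<open>Z a\<close>, hence on finite intersections, and it is not
  zero.\<close>

lemma flow_translated_orbit_closures_meet:
  assumes P: "compact_space P" "Hausdorff_space P" and Sg: "semitopological Sg"
    and rev: "left_reversible Sg \<or> left_amenable Sg"
    and act: "continuous_map (prod_topology Sg P) P (\<lambda>(s, k). A s k)"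
    and hom: "\<And>s t k. k \<in> topspace P \<Longrightarrow> A (s * t) k = A s (A t k)"
    and e: "e \<in> topspace P"
  obtains p where "\<And>a. p \<in> P closure_of (range (\<lambda>t. A (a * t) e))"
proof -
  define Z where "Z a = P closure_of (range (\<lambda>t. A (a * t) e))" for a
  have ts: "topspace Sg = UNIV" using Sg by (simp add: semitopological_def)
  have inP: "A s k \<in> topspace P" if "k \<in> topspace P" for s k
    using act that ts by (auto simp: continuous_map_def Pi_iff)
  have cl: "closedin P (Z a)" for a by (simp add: Z_def)
  have fin: "topspace P \<inter> (\<Inter>a\<in>F. Z a) \<noteq> {}" if "finite F" for F
    using rev
  proof
    assume "left_reversible Sg"
    define J where "J a = Sg closure_of (range ((*) a))" for a
    have J: "right_ideal (J a)" for a
    proof -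
      have "b * s \<in> J a" if "b \<in> J a" for b s
      proof -
        have "(\<lambda>t. t * s) ` J a \<subseteq> Sg closure_of ((\<lambda>t. t * s) ` range ((*) a))"
          unfolding J_def using Sg
          by (intro continuous_map_image_closure_subset) (simp add: semitopological_def)
        also have "\<dots> \<subseteq> J a"
          unfolding J_def by (intro closure_of_mono) (auto simp: mult.assoc)
        finally show ?thesis using that by blast
      qed
      moreover have "a * a \<in> J a"
        unfolding J_def using closure_of_subset[of "range ((*) a)" Sg] ts by auto
      ultimately show ?thesis unfolding right_ideal_def by blast
    qed
    \<comment> \<open>Reversibility concerns two ideals only; keeping the finite intersection a
      closed right ideal allows it to be applied again.\<close>
    have "closedin Sg (UNIV \<inter> (\<Inter>a\<in>F. J a)) \<and> right_ideal (UNIV \<inter> (\<Inter>a\<in>F. J a))"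
      using that
    proof (induction F)
      case empty
      show ?case using closedin_topspace[of Sg] ts by (simp add: right_ideal_def)
    next
      case (insert a F)
      let ?I = "UNIV \<inter> (\<Inter>a\<in>F. J a)"
      have "J a \<inter> ?I \<noteq> {}"
        using \<open>left_reversible Sg\<close> insert J[of a] unfolding left_reversible_def
        by (simp add: J_def)
      moreover have "closedin Sg (J a \<inter> ?I)"
        using insert.IH by (intro closedin_Int conjunct1[OF insert.IH]) (simp add: J_def)
      ultimately show ?case using J[of a] insert
        by (simp add: right_ideal_def)
    qed
    then obtain t where t: "\<And>a. a \<in> F \<Longrightarrow> t \<in> J a"
      unfolding right_ideal_def by blast
    have cont: "continuous_map Sg P (\<lambda>s. A s e)"
      using continuous_map_compose[OF _ act, of Sg "\<lambda>s. (s, e)"] e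
      by (simp add: o_def continuous_map_paired)
    have "A t e \<in> Z a" if "a \<in> F" for a
    proof -
      have "A t e \<in> P closure_of ((\<lambda>s. A s e) ` range ((*) a))"
        using continuous_map_image_closure_subset[OF cont, of "range ((*) a)"] t[OF that]
        unfolding J_def by blast
      then show ?thesis by (simp add: Z_def image_image)
    qed
    with inP[OF e] show ?thesis by blast
  next
    assume "left_amenable Sg"
    then obtain \<mu> where \<mu>:
      "(\<forall>f\<in>LUC Sg. \<forall>g\<in>LUC Sg. \<mu> (\<lambda>t. f t + g t) = \<mu> f + \<mu> g) \<and>
        (\<forall>f\<in>LUC Sg. \<forall>c. \<mu> (\<lambda>t. c * f t) = c * \<mu> f) \<and>
        (\<exists>K. \<forall>f\<in>LUC Sg. \<bar>\<mu> f\<bar> \<le> K * supnorm f) \<and>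
        (SUP f\<in>{f\<in>LUC Sg. supnorm f \<le> 1}. \<bar>\<mu> f\<bar>) = 1 \<and>
        \<mu> (\<lambda>_. 1) = 1 \<and>
        (\<forall>s. \<forall>f\<in>LUC Sg. \<mu> (ltrans s f) = \<mu> f)"
      unfolding left_amenable_def by (rule exE)
    from \<mu> have add: "\<And>f g. f \<in> LUC Sg \<Longrightarrow> g \<in> LUC Sg \<Longrightarrow> \<mu> (\<lambda>t. f t + g t) = \<mu> f + \<mu> g"
      by blast
    from \<mu> have scale: "\<And>f c. f \<in> LUC Sg \<Longrightarrow> \<mu> (\<lambda>t. c * f t) = c * \<mu> f"
      by blast
    from \<mu> have one: "\<mu> (\<lambda>_. 1) = 1" by blast
    from \<mu> have inv: "\<And>s f. f \<in> LUC Sg \<Longrightarrow> \<mu> (ltrans s f) = \<mu> f" by blast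
    from \<mu> obtain K where K: "\<And>f. f \<in> LUC Sg \<Longrightarrow> \<bar>\<mu> f\<bar> \<le> K * supnorm f"
      by blast
    have luc: "(\<lambda>t. f (A t e)) \<in> LUC Sg" if "continuous_map P euclideanreal f" for f
      by (rule flow_orbit_function_in_LUC[OF P(1) Sg act _ e that]) (rule hom)
    have luc1: "(\<lambda>_. 1) \<in> LUC Sg"
      using luc[of "\<lambda>_. 1"] by simp
    have "1 \<le> K" using K[OF luc1] one by (simp add: supnorm_def)
    have zero: "\<mu> (\<lambda>_. 0) = 0"
      using scale[OF luc1, of 0] by simp
    define M where "M f = \<mu> (\<lambda>t. f (A t e))" for f
    have M_add: "M (\<lambda>x. f x + g x) = M f + M g"
      if "continuous_map P euclideanreal f" "continuous_map P euclideanreal g" for f g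
      unfolding M_def using that by (intro add luc)
    have M_bound: "\<bar>M f\<bar> \<le> K * b"
      if "continuous_map P euclideanreal f" "\<And>x. x \<in> topspace P \<Longrightarrow> \<bar>f x\<bar> \<le> b" for f b
    proof -
      have "supnorm (\<lambda>t. f (A t e)) \<le> b"
        unfolding supnorm_def by (rule cSUP_least) (use that inP e in auto)
      then have "K * supnorm (\<lambda>t. f (A t e)) \<le> K * b"
        using \<open>1 \<le> K\<close> by (intro mult_left_mono) auto
      with K[OF luc[OF that(1)]] show ?thesis by (simp add: M_def)
    qed
    \<comment> \<open>Translating the orbit function of \<open>f\<close> by \<open>a\<close> samples
      \<open>f\<close> only on \<open>Z a\<close>, where it is 0; left invariance of the mean then
      gives the claim.\<close>
    have M_Z: "M f = 0" if f: "continuous_map P euclideanreal f" "\<And>x. x \<in> Z a \<Longrightarrow> f x = 0" for f a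
    proof -
      have "range (\<lambda>t. A (a * t) e) \<subseteq> Z a"
        unfolding Z_def by (rule closure_of_subset) (use inP e in auto)
      then have "ltrans a (\<lambda>t. f (A t e)) = (\<lambda>_. 0)"
        using f(2) by (auto simp: ltrans_def)
      then show ?thesis
        unfolding M_def using inv[OF luc[OF f(1)], of a] zero by simp
    qed
    have normal: "normal_space P"
      using P by (simp add: compact_Hausdorff_or_regular_imp_normal_space)
    have "closedin P (topspace P \<inter> (\<Inter>a\<in>F. Z a)) \<and>
      (\<forall>f. continuous_map P euclideanreal f \<longrightarrow> (\<forall>x\<in>topspace P \<inter> (\<Inter>a\<in>F. Z a). f x = 0) \<longrightarrow> M f = 0)"
      using that
    proof (induction F)
      case empty
      have "M f = 0" if "\<forall>x\<in>topspace P. f x = 0" for f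
        unfolding M_def using that inP[OF e] zero by simp
      then show ?case by simp
    next
      case (insert a F)
      let ?I = "topspace P \<inter> (\<Inter>a\<in>F. Z a)"
      have eq: "topspace P \<inter> (\<Inter>a\<in>insert a F. Z a) = Z a \<inter> ?I" by auto
      have I: "closedin P ?I" using insert by blast
      have "M f = 0" if f: "continuous_map P euclideanreal f" "\<forall>x\<in>Z a \<inter> ?I. f x = 0" for f
        by (rule mean_vanishing_off_Int[where M = M and K = K, OF normal cl I M_add M_bound M_Z _ f(1)])
          (use insert f in auto)
      with eq I cl show ?case by (metis closedin_Int)
    qed
    \<comment> \<open>On an empty intersection the constant 1 would vanish vacuously, and its mean
      would have to be 0.\<close>
    moreover have "M (\<lambda>_. 1) = 1" by (simp add: M_def one)
    ultimately show ?thesis by auto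
  qed
  have "topspace P \<inter> \<Inter>\<F> \<noteq> {}" if "finite \<F>" "\<F> \<subseteq> range Z" for \<F>
    using finite_subset_image[OF that] fin by auto
  moreover have "compactin P (topspace P)" using P by (simp add: compact_space_def)
  ultimately have "topspace P \<inter> \<Inter>(range Z) \<noteq> {}"
    using cl conjunct2[OF iffD1[OF compactin_fip], of P "topspace P", rule_format, of "range Z"]
    by auto
  then show thesis using that unfolding Z_def by blast
qed

section \<open>The retraction\<close>

text \<open>Regularity at 0, from continuity of subtraction: if \<open>U - V\<close> lies in
  \<open>W\<close> and \<open>z\<close> is in the closure of \<open>U\<close>, some \<open>w\<close>
  in \<open>U\<close> has \<open>w - z\<close> in \<open>V\<close>, so
  \<open>z = w - (w - z)\<close> is in \<open>W\<close>. Closed neighbourhoods are what survives the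
  passage to pointwise limits below.\<close>

lemma linear_topology_closed_nhd_of_0:
  assumes lt: "linear_topology tau" and W: "openin tau W" "0 \<in> W"
  obtains N where "openin tau N" "0 \<in> N" "tau closure_of N \<subseteq> W"
proof -
  have ts: "topspace tau = UNIV" using lt by (simp add: linear_topology_def)
  let ?X = "prod_topology tau tau"
  have "continuous_map ?X tau (\<lambda>w. fst w - snd w)"
    by (intro linear_topology_continuous_diff lt continuous_map_fst continuous_map_snd)
  then have "openin ?X {w \<in> topspace ?X. fst w - snd w \<in> W}"
    using W(1) by (rule openin_continuous_map_preimage)
  then have "\<exists>U V. openin tau U \<and> openin tau V \<and> 0 \<in> U \<and> 0 \<in> V \<and>
      U \<times> V \<subseteq> {w \<in> topspace ?X. fst w - snd w \<in> W}"
    unfolding openin_prod_topology_alt by (elim allE[of _ 0] impE) (use W ts in auto)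
  then obtain U V where UV: "openin tau U" "openin tau V" "0 \<in> U" "0 \<in> V"
    "U \<times> V \<subseteq> {w \<in> topspace ?X. fst w - snd w \<in> W}"
    by auto
  have "z \<in> W" if z: "z \<in> tau closure_of U" for z
  proof -
    have "continuous_map tau tau (\<lambda>w. w - z)"
      using ts by (intro linear_topology_continuous_diff lt) auto
    then have "openin tau {w \<in> topspace tau. w - z \<in> V}"
      using UV(2) by (rule openin_continuous_map_preimage)
    moreover have "z \<in> {w \<in> topspace tau. w - z \<in> V}"
      using UV ts by simp
    moreover have "\<forall>Q. z \<in> Q \<and> openin tau Q \<longrightarrow> (\<exists>w. w \<in> U \<and> w \<in> Q)"
      using z by (simp add: in_closure_of)
    ultimately have "\<exists>w. w \<in> U \<and> w \<in> {w \<in> topspace tau. w - z \<in> V}"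
      by (metis (no_types, lifting))
    then obtain w where "w \<in> U" "w - z \<in> V"
      by blast
    then have "(w, w - z) \<in> {w \<in> topspace ?X. fst w - snd w \<in> W}"
      using UV(5) by blast
    then show ?thesis by simp
  qed
  with UV that show thesis by blast
qed

text \<open>Averaged affine maps are affine self-maps of the convex set \<open>C\<close>, and such
  maps are closed under composition. This transfers affinity from the generators to every
  \<open>T s\<close>.\<close>

lemma foldr_comp_averaged_affine:
  assumes "convex C" "\<And>g. g \<in> set gs \<Longrightarrow> averaged_affine C g"
  shows "foldr (\<circ>) gs id ` C \<subseteq> C \<and> affine_on C (foldr (\<circ>) gs id)"
  using assms(2)
proof (induction gs)
  case Nil
  then show ?case by (simp add: affine_on_def)
next
  case (Cons g gs)
  obtain a U where a: "0 < a" "a < 1" "U ` C \<subseteq> C" "affine_on C U"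
    "\<And>x. x \<in> C \<Longrightarrow> g x = a *\<^sub>R x + (1 - a) *\<^sub>R U x"
    using Cons.prems[of g] unfolding averaged_affine_def by auto
  have gC: "g x \<in> C" if "x \<in> C" for x
    unfolding a(5)[OF that] using that a assms(1) by (intro convexD) auto
  have ga: "g (l *\<^sub>R x + (1 - l) *\<^sub>R y) = l *\<^sub>R g x + (1 - l) *\<^sub>R g y"
    if "x \<in> C" "y \<in> C" "0 \<le> l" "l \<le> 1" for x y l
  proof -
    have "l *\<^sub>R x + (1 - l) *\<^sub>R y \<in> C"
      using that assms(1) by (intro convexD) auto
    moreover have "U (l *\<^sub>R x + (1 - l) *\<^sub>R y) = l *\<^sub>R U x + (1 - l) *\<^sub>R U y"
      using a(4) that unfolding affine_on_def by blast
    ultimately show ?thesis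
      using that by (simp add: a(5) scaleR_add_right scaleR_diff_right mult.commute add_ac)
  qed
  define F where "F = foldr (\<circ>) gs id"
  have "F ` C \<subseteq> C \<and> affine_on C F"
    unfolding F_def by (rule Cons.IH) (use Cons.prems in simp)
  then have "(\<lambda>x. g (F x)) ` C \<subseteq> C \<and> affine_on C (\<lambda>x. g (F x))"
    using gC ga by (simp add: affine_on_def image_subset_iff)
  moreover have "foldr (\<circ>) (g # gs) id = (\<lambda>x. g (F x))"
    by (rule ext) (simp add: F_def)
  ultimately show ?case
    by (simp only:)
qed

lemma foldr_comp_fixed:
  "(\<And>g. g \<in> set gs \<Longrightarrow> g x = x) \<Longrightarrow> foldr (\<circ>) gs id x = x"
  by (induction gs) auto

theorem theorem4p4:
  fixes tau :: "'a::banach topology"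
    and Sg :: "'s::semigroup_mult topology"
    and C :: "'a set"
    and T :: "'s \<Rightarrow> 'a \<Rightarrow> 'a"
  assumes "linear_topology tau"
    and "convex C" and "bounded C" and "compactin tau C"
    and "semitopological Sg"
    and "left_reversible Sg \<or> left_amenable Sg"
    and "representation C T"
    and "continuous_map (prod_topology Sg (subtopology tau C)) (subtopology tau C)
           (\<lambda>(s, x). T s x)"
    and "generated_by_averaged_affine C T"
  shows "(\<exists>r. r ` C = Fix C T \<and> affine_on C r \<and> (\<forall>x\<in>C. r (r x) = r x)) \<and>
         (locally_equicontinuous tau C T \<longrightarrow>
           (\<exists>r. r ` C = Fix C T \<and> affine_on C r \<and> (\<forall>x\<in>C. r (r x) = r x) \<and>
                continuous_map (subtopology tau C) tau r))"
proof -
  note lt = assms(1) and jc = assms(8)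
  have ts: "topspace tau = UNIV" "Hausdorff_space tau" "topspace Sg = UNIV"
    using lt assms(5) by (auto simp: linear_topology_def semitopological_def)
  have TC: "T s x \<in> C" if "x \<in> C" for s x
    using assms(7) that by (auto simp: representation_def)
  have hom: "T (s * t) x = T s (T t x)" if "x \<in> C" for s t x
    using assms(7) that by (auto simp: representation_def)

  \<comment> \<open>The semigroup flow on the self-maps of C\<close>
  let ?Y = "subtopology tau C"
  have Y: "topspace ?Y = C" "Hausdorff_space ?Y" "compact_space ?Y"
    using ts assms(4) by (auto simp: Hausdorff_space_subtopology compact_space_subtopology)
  \<comment> \<open>All self-maps of \<open>C\<close> with pointwise convergence, compact by
    Tychonoff. Its points are extensional functions, hence the restrictions to \<open>C\<close> in
    what follows.\<close>
  define P where "P = product_topology (\<lambda>_. ?Y) C"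
  have P: "compact_space P" "Hausdorff_space P" "topspace P = C \<rightarrow>\<^sub>E C"
    using Y by (simp_all add: P_def compact_space_product_topology Hausdorff_space_product_topology)
  have coord: "continuous_map P ?Y (\<lambda>k. k x)" if "x \<in> C" for x
    unfolding P_def using that by (rule continuous_map_product_coordinates)
  have coord': "continuous_map P tau (\<lambda>k. k x)" if "x \<in> C" for x
    using coord[OF that] by (simp add: continuous_map_in_subtopology)
  define A where "A s k = restrict (\<lambda>x. T s (k x)) C" for s k
  have act: "continuous_map (prod_topology Sg P) P (\<lambda>(s, k). A s k)"
  proof -
    have "continuous_map (prod_topology Sg P) ?Y (\<lambda>w. A (fst w) (snd w) x)" if "x \<in> C" for x
    proof -
      have "continuous_map (prod_topology Sg P) ?Y ((\<lambda>k. k x) \<circ> snd)"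
        by (rule continuous_map_compose[OF continuous_map_snd coord[OF that]])
      then have "continuous_map (prod_topology Sg P) (prod_topology Sg ?Y) (\<lambda>w. (fst w, snd w x))"
        by (intro continuous_map_pairedI continuous_map_fst) (simp add: o_def)
      from continuous_map_compose[OF this jc] show ?thesis
        using that by (simp add: o_def A_def)
    qed
    then show ?thesis
      unfolding P_def continuous_map_componentwise
      by (auto simp: case_prod_unfold A_def P_def)
  qed
  \<comment> \<open>The orbit of the identity map under left composition is the family of all
    \<open>T t\<close>.\<close>
  define e where "e = restrict (\<lambda>x. x) C"
  have e: "e \<in> topspace P" by (simp add: P e_def)
  have Ae: "A t e = restrict (T t) C" for t
    by (auto simp: A_def e_def fun_eq_iff)
  have "A (s * t) k = A s (A t k)" if "k \<in> topspace P" for s t k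
    using that hom by (fastforce simp: A_def P PiE_iff fun_eq_iff)
  from flow_translated_orbit_closures_meet[OF P(1,2) assms(5,6) act this e]
  obtain p where p: "\<And>a. p \<in> P closure_of range (\<lambda>t. restrict (T (a * t)) C)"
    unfolding Ae by blast
  have pC: "p x \<in> C" if "x \<in> C" for x
    using p[THEN subsetD[OF closure_of_subset_topspace]] that by (auto simp: P)
  \<comment> \<open>Forgetting \<open>a\<close>, \<open>p\<close> is a pointwise cluster point of
    the \<open>T t\<close>; this suffices for every property except that its values are fixed
    points.\<close>
  have p': "p \<in> P closure_of range (\<lambda>t. restrict (T t) C)"
    by (rule subsetD[OF closure_of_mono p]) auto
  obtain G where G: "\<And>g. g \<in> G \<Longrightarrow> averaged_affine C g"
    and gen: "(\<lambda>s. restrict (T s) C) ` UNIV =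
          (\<lambda>gs. restrict (foldr (\<circ>) gs id) C) ` {gs. gs \<noteq> [] \<and> set gs \<subseteq> G}"
    using assms(9) unfolding generated_by_averaged_affine_def by auto

  \<comment> \<open>Words in the generators\<close>
  have word: "\<exists>gs. set gs \<subseteq> G \<and> (\<forall>x\<in>C. T s x = foldr (\<circ>) gs id x)" for s
  proof -
    have "restrict (T s) C \<in> (\<lambda>gs. restrict (foldr (\<circ>) gs id) C) ` {gs. gs \<noteq> [] \<and> set gs \<subseteq> G}"
      using gen by blast
    then obtain gs where "set gs \<subseteq> G" "restrict (T s) C = restrict (foldr (\<circ>) gs id) C"
      by blast
    then show ?thesis by (metis restrict_apply')
  qed
  have letter: "\<exists>s. \<forall>x\<in>C. T s x = g x" if "g \<in> G" for g
  proof -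
    have "restrict (foldr (\<circ>) [g] id) C \<in> (\<lambda>s. restrict (T s) C) ` UNIV"
      unfolding gen using that by (intro imageI) simp
    then obtain s where "restrict g C = restrict (T s) C"
      by auto
    then show ?thesis by (metis restrict_apply')
  qed
  have T_aff: "affine_on C (T s)" for s
  proof -
    obtain gs where gs: "set gs \<subseteq> G" "\<forall>x\<in>C. T s x = foldr (\<circ>) gs id x"
      using word by blast
    then have "affine_on C (foldr (\<circ>) gs id)"
      using foldr_comp_averaged_affine[OF assms(2)] G by blast
    moreover have "l *\<^sub>R x + (1 - l) *\<^sub>R y \<in> C" if "x \<in> C" "y \<in> C" "0 \<le> l" "l \<le> 1" for x y and l :: real
      using that assms(2) by (intro convexD) auto
    ultimately show ?thesis using gs(2) by (simp add: affine_on_def)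
  qed

  \<comment> \<open>Identities inherited by the pointwise limit\<close>
  have p_aff: "affine_on C p"
    unfolding affine_on_def
  proof (intro ballI allI impI)
    fix x y and l :: real assume xy: "x \<in> C" "y \<in> C" and l: "0 \<le> l \<and> l \<le> 1"
    have z: "l *\<^sub>R x + (1 - l) *\<^sub>R y \<in> C"
      using xy l assms(2) by (intro convexD) auto
    have "continuous_map P tau (\<lambda>k. l *\<^sub>R k x + (1 - l) *\<^sub>R k y)"
      using xy by (intro linear_topology_continuous_add linear_topology_continuous_scaleR lt coord') auto
    then show "p (l *\<^sub>R x + (1 - l) *\<^sub>R y) = l *\<^sub>R p x + (1 - l) *\<^sub>R p y"
      using T_aff xy z l
      \<comment> \<open>For fixed \<open>x\<close>, \<open>y\<close>, \<open>l\<close> both sides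
        depend continuously on the map, so the equation defines a closed set in the Hausdorff
        setting; it contains every \<open>T t\<close> and therefore \<open>p\<close>.\<close>
      by (intro forall_in_closure_of_eq[OF p' ts(2) coord'[OF z]]) (auto simp: affine_on_def)
  qed
  have p_fix: "p x = x" if "x \<in> Fix C T" for x
  proof -
    have "x \<in> C" using that by (simp add: Fix_def)
    with that show ?thesis
      using ts(1) by (intro forall_in_closure_of_eq[OF p' ts(2) coord']) (auto simp: Fix_def)
  qed

  \<comment> \<open>Values of the limit are common fixed points\<close>
  have p_range: "p x \<in> Fix C T" if x: "x \<in> C" for x
  proof -
    \<comment> \<open>Generators suffice, since each \<open>T s\<close> agrees on \<open>C\<close>
      with a word in them. For a generator, it remains to place \<open>p x\<close> in the range of
      every power.\<close>
    have fix_g: "g (p x) = p x" if "g \<in> G" for g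
    proof -
      obtain s where s: "\<And>x. x \<in> C \<Longrightarrow> T s x = g x" using letter[OF \<open>g \<in> G\<close>] by blast
      have cont: "continuous_map ?Y ?Y g"
      proof -
        have "continuous_map ?Y ?Y ((\<lambda>(s, x). T s x) \<circ> (\<lambda>x. (s, x)))"
          using ts by (intro continuous_map_compose[OF _ jc] continuous_map_pairedI) auto
        then show ?thesis
          by (rule continuous_map_eq) (use s ts in auto)
      qed
      have "p x \<in> (g ^^ n) ` C" for n
      proof -
        have gn: "continuous_map ?Y ?Y (g ^^ n)"
        proof (induction n)
          case (Suc n)
          then show ?case using continuous_map_compose[OF Suc cont] by (simp add: o_def)
        qed (simp add: id_def)
        have "compactin ?Y ((g ^^ n) ` C)"
          by (rule image_compactin[OF _ gn]) (use Y in \<open>simp add: compact_space_def\<close>)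
        then have "closedin ?Y ((g ^^ n) ` C)"
          using Y by (intro compactin_imp_closedin)
        then have cl: "closedin P {k \<in> topspace P. k x \<in> (g ^^ n) ` C}"
          by (rule closedin_continuous_map_preimage[OF coord[OF x]])
        \<comment> \<open>This is the power of \<open>s\<close> with exponent \<open>n + 1\<close>,
          started at \<open>s\<close> because the semigroup has no designated identity. Then
          \<open>T (a * t) x\<close> lies in the range of \<open>g ^^ n\<close> for all
          \<open>t\<close>, and this range is compact, hence closed in \<open>C\<close>, so
          \<open>p x\<close> stays in it.\<close>
        define a where "a = (((*) s) ^^ n) s"
        have Ta: "T ((((*) s) ^^ m) t) y = (g ^^ m) (T t y)" if "y \<in> C" for m t y
        proof (induction m)
          case (Suc m)
          have "T ((((*) s) ^^ m) t) y \<in> C" using that by (rule TC)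
          with Suc s show ?case using that by (simp add: hom)
        qed simp
        have "T (a * t) x \<in> (g ^^ n) ` C" for t
          using x unfolding a_def by (simp add: hom Ta TC)
        with x show ?thesis
          by (intro forall_in_closure_of[OF p[of a] _ cl]) auto
      qed
      then show ?thesis
        using averaged_affine_fixes_eventual_range[OF lt assms(4,2) G[OF \<open>g \<in> G\<close>]] by blast
    qed
    have "T s (p x) = p x" for s
    proof -
      obtain gs where gs: "set gs \<subseteq> G" "\<forall>x\<in>C. T s x = foldr (\<circ>) gs id x"
        using word by blast
      then show ?thesis using foldr_comp_fixed[of gs "p x"] fix_g pC[OF x] by auto
    qed
    with pC[OF x] show ?thesis by (simp add: Fix_def)
  qed
  have image: "p ` C = Fix C T"
  proof
    show "Fix C T \<subseteq> p ` C"
    proof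
      fix x assume x: "x \<in> Fix C T"
      then show "x \<in> p ` C"
        using p_fix[OF x] by (intro image_eqI[of _ _ x]) (simp_all add: Fix_def)
    qed
  qed (use p_range in blast)

  \<comment> \<open>Continuity under local equicontinuity\<close>
  have "continuous_map ?Y tau p" if eq: "locally_equicontinuous tau C T"
  proof -
    have "\<exists>V. openin ?Y V \<and> x0 \<in> V \<and> (\<forall>x\<in>V. p x \<in> W)"
      if x0: "x0 \<in> C" and W: "openin tau W" "p x0 \<in> W" for x0 W
    proof -
      have "continuous_map tau tau (\<lambda>b. p x0 + b)"
        using ts by (intro linear_topology_continuous_add lt) auto
      then have "openin tau {b \<in> topspace tau. p x0 + b \<in> W}"
        using W(1) by (rule openin_continuous_map_preimage)
      then obtain N where N: "openin tau N" "0 \<in> N" "tau closure_of N \<subseteq> {b \<in> topspace tau. p x0 + b \<in> W}"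
        using linear_topology_closed_nhd_of_0[OF lt] W ts
        by (metis (mono_tags, lifting) UNIV_I add.right_neutral mem_Collect_eq)
      have "tau_nhd tau 0 N" using N by (auto simp: tau_nhd_def)
      with eq x0 obtain V where V: "tau_nhd tau x0 V"
          "\<And>s x y. x \<in> V \<inter> C \<Longrightarrow> y \<in> V \<inter> C \<Longrightarrow> T s x - T s y \<in> N"
        unfolding locally_equicontinuous_def by blast
      obtain V' where V': "openin tau V'" "x0 \<in> V'" "V' \<subseteq> V"
        using V(1) unfolding tau_nhd_def by blast
      have "p x \<in> W" if x: "x \<in> V' \<inter> C" for x
      proof -
        have "continuous_map P tau (\<lambda>k. k x - k x0)"
          using x x0 by (intro linear_topology_continuous_diff lt coord') auto
        \<comment> \<open>The neighbourhood \<open>V\<close> works for all \<open>s\<close> at once,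
          so the estimate holds along the whole family. The limit satisfies it with the closure of
          \<open>N\<close>, which was chosen so that its translate by \<open>p x0\<close> still lies
          in \<open>W\<close>.\<close>
        then have "closedin P {k \<in> topspace P. k x - k x0 \<in> tau closure_of N}"
          by (rule closedin_continuous_map_preimage) simp
        moreover have "T s x - T s x0 \<in> tau closure_of N" for s
          using V(2)[of x x0 s] V' x x0 closure_of_subset[of N tau] ts by auto
        ultimately have "p x - p x0 \<in> tau closure_of N"
          using x x0 by (intro forall_in_closure_of[OF p', of "\<lambda>k. k x - k x0 \<in> tau closure_of N"]) auto
        with N(3) have "p x0 + (p x - p x0) \<in> W" by blast
        then show ?thesis by simp
      qed
      then show ?thesis
        using V' x0 by (intro exI[of _ "V' \<inter> C"]) (auto simp: openin_subtopology)
    qed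
    then have "openin ?Y {x \<in> topspace ?Y. p x \<in> W}" if "openin tau W" for W
      using that Y(1) by (subst openin_subopen) (smt (verit) mem_Collect_eq openin_subset subset_eq)
    then show ?thesis using ts by (simp add: continuous_map_def)
  qed
  moreover have "\<forall>x\<in>C. p (p x) = p x" using p_range p_fix by blast
  ultimately show ?thesis using image p_aff by blast
qed

end
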